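(* Consider the problem $\min_{x\in\mathbb R^n} f(x)$ subject to $Ax=b$, where $f:\mathbb R^n\to\mathbb R$ is convex and continuously differentiable, $A\in\mathbb R^{m\times n}$, $b\in\mathbb R^m$, and assume the KKT set $\Omega$ is nonempty. Let $\{(x_k,\lambda_k)\}_{k\ge0}$ be generated by the accelerated augmented Lagrangian method described in the context (in either Case I or Case II). Then there exists $(x^*,\lambda^* )\in\Omega$ such that $(x_k,\lambda_k)\to(x^*,\lambda^* )$ as $k\to+\infty$.
   Context: The KKT set is $\Omega=\{(x^*,\lambda^* )\in\mathbb R^n\times\mathbb R^m: Ax^*=b,\ \nabla f(x^* )+A^\top\lambda^*=0\}$. Parameter sequence: $\{t_k\}_{k\ge1}$ is nondecreasing, $t_1=1$, $t_k>1$ for all $k>2$, $t_k\to+\infty$, and $t_{k+1}^2-t_k^2\le\rho t_{k+1}$ for all $k\ge 1$, with fixed $\rho\in(0,1]$. Fix $\eta\in[\rho,1]$, $\gamma>0$, $\delta>0$, $\beta\ge0$. Algorithm: initial points $x_0=x_1\in\mathbb R^n$, $\lambda_0=\lambda_1\in\mathbb R^m$. For $k=1,2,\dots$: set $\alpha_k=(t_{k+1}-\eta)/\eta$, $c_k=t_{k+1}/\eta$, $\bar x_k=x_k+\frac{t_k-1}{t_{k+1}}(x_k-x_{k-1})$, $\bar\lambda_k=\lambda_k+\frac{t_k-1}{t_{k+1}}(\lambda_k-\lambda_{k-1})$, $p_k=c_k\bar\lambda_k-\alpha_k\lambda_k$, $r_k=\alpha_kAx_k+b$. Case I ($f$ convex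 and $C^1$): $x_{k+1}=\arg\min_{x}\{f(x)+\frac\beta2\|Ax-b\|^2+\frac1{2\gamma}\|x-\bar x_k\|^2+\langle p_k,Ax-b\rangle+\frac\delta2\|c_kAx-r_k\|^2\}$. Case II ($f$ convex with $L$-Lipschitz gradient, and $\gamma\le 1/L$): $x_{k+1}=\arg\min_{x}\{\langle\nabla f(\bar x_k),x\rangle+\frac\beta2\|Ax-b\|^2+\frac1{2\gamma}\|x-\bar x_k\|^2+\langle p_k,Ax-b\rangle+\frac\delta2\|c_kAx-r_k\|^2\}$. Then $\lambda_{k+1}=\bar\lambda_k+\delta(c_kAx_{k+1}-r_k)$. *)

theory Defs
  imports "HOL-Analysis.Analysis"
begin

text \<open>Vectors in R^n are real^'n, in R^m are real^'m; A is an m x n matrix (real^'n^'m).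
  The gradient of f is given as a function grad_f with
  (f has_derivative (\<lambda>h. grad_f x \<bullet> h)) (at x).\<close>

definition kkt_set ::
  "real^'n^'m \<Rightarrow> real^'m \<Rightarrow> (real^'n \<Rightarrow> real^'n) \<Rightarrow> ((real^'n) \<times> (real^'m)) set" where
  "kkt_set A b grad_f =
     {(xs, ls). A *v xs = b \<and> grad_f xs + transpose A *v ls = 0}"

text \<open>Subproblem objective: g is the smooth part (f in Case I, the linearization
  y \<mapsto> <grad f(xbar), y> in Case II).\<close>
definition aalm_obj ::
  "(real^'n \<Rightarrow> real) \<Rightarrow> real^'n^'m \<Rightarrow> real^'m \<Rightarrow> real \<Rightarrow> real \<Rightarrow> real \<Rightarrow>
   real^'n \<Rightarrow> real^'m \<Rightarrow> real \<Rightarrow> real^'m \<Rightarrow> real^'n \<Rightarrow> real" where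
  "aalm_obj g A b \<beta> \<gamma> \<delta> xbar p c r y =
     g y + \<beta> / 2 * (norm (A *v y - b))\<^sup>2 + 1 / (2 * \<gamma>) * (norm (y - xbar))\<^sup>2
     + p \<bullet> (A *v y - b) + \<delta> / 2 * (norm (c *\<^sub>R (A *v y) - r))\<^sup>2"

text \<open>One iteration k (k \<ge> 1) of the accelerated augmented Lagrangian method.
  The parameter G maps the extrapolated point xbar_k to the smooth part g used
  in the subproblem.\<close>
definition aalm_step ::
  "(real^'n \<Rightarrow> real^'n \<Rightarrow> real) \<Rightarrow> real^'n^'m \<Rightarrow> real^'m \<Rightarrow> (nat \<Rightarrow> real) \<Rightarrow>
   real \<Rightarrow> real \<Rightarrow> real \<Rightarrow> real \<Rightarrow> (nat \<Rightarrow> real^'n) \<Rightarrow> (nat \<Rightarrow> real^'m) \<Rightarrow> nat \<Rightarrow> bool" where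
  "aalm_step G A b t \<eta> \<beta> \<gamma> \<delta> x l k \<longleftrightarrow>
     (let \<alpha> = (t (k+1) - \<eta>) / \<eta>;
          c = t (k+1) / \<eta>;
          xb = x k + ((t k - 1) / t (k+1)) *\<^sub>R (x k - x (k-1));
          lb = l k + ((t k - 1) / t (k+1)) *\<^sub>R (l k - l (k-1));
          p = c *\<^sub>R lb - \<alpha> *\<^sub>R l k;
          r = \<alpha> *\<^sub>R (A *v x k) + b
      in (\<forall>y. aalm_obj (G xb) A b \<beta> \<gamma> \<delta> xb p c r (x (k+1))
               \<le> aalm_obj (G xb) A b \<beta> \<gamma> \<delta> xb p c r y)
         \<and> l (k+1) = lb + \<delta> *\<^sub>R (c *\<^sub>R (A *v x (k+1)) - r))"

end

theory Submission
  imports Defs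
begin

text \<open>
  Write \<open>z\<^sub>k = (x\<^sub>k, \<lambda>\<^sub>k)\<close>, and let \<open>L\<close> be the augmented Lagrangian. For a KKT point
  \<open>z* = (x*, \<lambda>*)\<close> put \<open>u\<^sub>k = \<eta> (z\<^sub>k - z*) + (t\<^sub>k - 1) (z\<^sub>k - z\<^sub>k\<^sub>-\<^sub>1)\<close>. The energy
  \<open>2 t\<^sub>k\<^sup>2 (L(x\<^sub>k, \<lambda>*) - L(x*, \<lambda>*)) + |u\<^sub>k|\<^sup>2 + \<eta> (1 - \<eta>) |z\<^sub>k - z*|\<^sup>2\<close>, with norms weighted
  by \<open>1 / \<gamma>\<close> and \<open>1 / \<delta>\<close>, is nonincreasing: the bilinear terms of the primal and dual steps
  cancel. Hence the iterates are bounded and \<open>L(x\<^sub>k, \<lambda>*)\<close> tends to \<open>L(x*, \<lambda>*)\<close>.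

  Both \<open>A x\<^sub>k\<close> and \<open>A\<^sup>T \<lambda>\<^sub>k\<close> satisfy an averaging recursion with weights \<open>\<eta> / t\<^sub>k\<close>. Since \<open>t\<^sub>k\<close>
  grows at most linearly these weights are not summable, so that \<open>A x\<^sub>k\<close> tends to \<open>b\<close> and
  \<open>A\<^sup>T \<lambda>\<^sub>k\<close> to \<open>A\<^sup>T \<lambda>*\<close>. It follows that every cluster point of \<open>z\<^sub>k\<close> is a KKT point.

  For two KKT points the difference of the energies is affine in the iterates and equals
  \<open>2 \<eta> (a\<^sub>k + (t\<^sub>k - 1) (a\<^sub>k - a\<^sub>k\<^sub>-\<^sub>1))\<close> up to a constant, where \<open>a\<^sub>k\<close> is the weighted inner
  product of \<open>z\<^sub>k\<close> with the difference of the two points. It converges, so \<open>a\<^sub>k\<close> converges by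
  averaging again, and two distinct cluster points are impossible.
\<close>

section \<open>Gradients of convex functions\<close>

lemma has_real_derivative_along_line:
  fixes f :: "'a::real_inner \<Rightarrow> real"
  assumes "\<And>z. (f has_derivative (\<lambda>h. g z \<bullet> h)) (at z)"
  shows "((\<lambda>s. f (a + s *\<^sub>R h)) has_real_derivative g (a + s *\<^sub>R h) \<bullet> h) (at s within S)"
proof -
  have "((\<lambda>s. a + s *\<^sub>R h) has_derivative (\<lambda>d. d *\<^sub>R h)) (at s within S)"
    by (auto intro!: derivative_eq_intros)
  from has_derivative_compose[OF this assms] show ?thesis
    by (simp add: has_field_derivative_def mult.commute[of _ "g (a + s *\<^sub>R h) \<bullet> h"])
qed

lemma convex_on_imp_above_gradient:
  fixes f :: "'a::real_inner \<Rightarrow> real"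
  assumes convex: "convex_on UNIV f" and grad: "\<And>z. (f has_derivative (\<lambda>h. g z \<bullet> h)) (at z)"
  shows "f a + g a \<bullet> (y - a) \<le> f y"
proof -
  define \<phi> where "\<phi> s = f (a + s *\<^sub>R (y - a))" for s :: real
  have "convex_on UNIV \<phi>"
  proof (rule convex_onI)
    fix u r s :: real
    assume u: "0 < u" "u < 1"
    have "a + ((1 - u) *\<^sub>R r + u *\<^sub>R s) *\<^sub>R (y - a)
        = (1 - u) *\<^sub>R (a + r *\<^sub>R (y - a)) + u *\<^sub>R (a + s *\<^sub>R (y - a))"
      by (simp add: algebra_simps)
    then show "\<phi> ((1 - u) *\<^sub>R r + u *\<^sub>R s) \<le> (1 - u) * \<phi> r + u * \<phi> s"
      using convex_onD[OF convex, of u "a + r *\<^sub>R (y - a)" "a + s *\<^sub>R (y - a)"] u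
      by (simp add: \<phi>_def)
  qed simp
  moreover have "(\<phi> has_real_derivative g a \<bullet> (y - a)) (at 0)"
    using has_real_derivative_along_line[OF grad, of a "y - a" 0 UNIV]
    by (simp add: \<phi>_def[abs_def])
  ultimately have "g a \<bullet> (y - a) * (1 - 0) \<le> \<phi> 1 - \<phi> 0"
    by (intro convex_on_imp_above_tangent[of UNIV]) auto
  then show ?thesis by (simp add: \<phi>_def)
qed

lemma lipschitz_gradient_quadratic_upper_bound:
  fixes f :: "'a::real_inner \<Rightarrow> real"
  assumes grad: "\<And>z. (f has_derivative (\<lambda>h. g z \<bullet> h)) (at z)" and lipschitz: "L-lipschitz_on UNIV g"
  shows "f y \<le> f a + g a \<bullet> (y - a) + L / 2 * (norm (y - a))\<^sup>2"
proof -
  define h where "h = y - a"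
  define \<phi> where "\<phi> s = f (a + s *\<^sub>R h) - s * (g a \<bullet> h) - L / 2 * s\<^sup>2 * (norm h)\<^sup>2" for s :: real
  define \<phi>' where "\<phi>' s = g (a + s *\<^sub>R h) \<bullet> h - g a \<bullet> h - L * s * (norm h)\<^sup>2" for s :: real
  have "\<phi>' s \<le> 0" if "0 \<le> s" for s
  proof -
    have "(g (a + s *\<^sub>R h) - g a) \<bullet> h \<le> norm (g (a + s *\<^sub>R h) - g a) * norm h"
      by (rule norm_cauchy_schwarz)
    also have "\<dots> \<le> (L * (s * norm h)) * norm h"
      using lipschitz_onD[OF lipschitz, of "a + s *\<^sub>R h" a] that
      by (intro mult_right_mono) (auto simp: dist_norm)
    finally show ?thesis by (simp add: \<phi>'_def power2_eq_square inner_diff_left)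
  qed
  moreover have "(\<phi> has_real_derivative \<phi>' s) (at s)" for s
    unfolding \<phi>_def \<phi>'_def
    by (auto intro!: derivative_eq_intros has_real_derivative_along_line[OF grad])
  ultimately have "\<phi> 1 \<le> \<phi> 0"
    by (intro DERIV_nonpos_imp_nonincreasing[of 0 1 \<phi>]) auto
  then show ?thesis by (simp add: h_def \<phi>_def)
qed

lemma convex_lipschitz_gradient_three_points:
  fixes f :: "'a::real_inner \<Rightarrow> real"
  assumes "convex_on UNIV f" and "\<And>z. (f has_derivative (\<lambda>h. g z \<bullet> h)) (at z)"
    and "L-lipschitz_on UNIV g"
  shows "f a - f y \<le> g q \<bullet> (a - y) + L / 2 * (norm (a - q))\<^sup>2"
  using convex_on_imp_above_gradient[OF assms(1,2), of q y]
    lipschitz_gradient_quadratic_upper_bound[OF assms(2,3), of a q]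
  by (simp add: inner_diff_right)

section \<open>Averaging recursions\<close>

lemma filterlim_sum_at_top_if_not_summable:
  fixes s :: "nat \<Rightarrow> real"
  assumes nonneg: "\<And>k. 0 \<le> s k" and div: "\<not> summable s"
  shows "filterlim (\<lambda>n. \<Sum>k<n. s k) at_top sequentially"
  unfolding filterlim_at_top eventually_sequentially
proof
  fix Z
  obtain N where N: "Z \<le> (\<Sum>k<N. s k)"
    using summableI_nonneg_bounded[of s Z] nonneg div by (meson linear)
  have "Z \<le> (\<Sum>k<n. s k)" if "N \<le> n" for n
    using N that nonneg sum_mono2[of "{..<n}" "{..<N}" s] by force
  then show "\<exists>N. \<forall>n\<ge>N. Z \<le> (\<Sum>k<n. s k)" by blast
qed

lemma contraction_le_exp_sum:
  fixes d s :: "nat \<Rightarrow> real"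
  assumes nonneg: "\<And>k. 0 \<le> d k" and step: "\<And>k. d (Suc k) \<le> (1 - s k) * d k"
  shows "d n \<le> exp (- (\<Sum>k<n. s k)) * d 0"
proof (induction n)
  case (Suc n)
  have "d (Suc n) \<le> (1 - s n) * d n" by (rule step)
  also have "\<dots> \<le> exp (- s n) * d n"
    using exp_ge_add_one_self[of "- s n"] nonneg by (intro mult_right_mono) auto
  also have "\<dots> \<le> exp (- s n) * (exp (- (\<Sum>k<n. s k)) * d 0)"
    using Suc by (intro mult_left_mono) auto
  also have "\<dots> = exp (- (\<Sum>k<Suc n. s k)) * d 0"
    by (simp add: exp_diff exp_minus field_simps)
  finally show ?case .
qed simp

lemma contraction_tendsto_0:
  fixes d s :: "nat \<Rightarrow> real"
  assumes nonneg: "\<And>k. 0 \<le> d k" and step: "\<And>k. d (Suc k) \<le> (1 - s k) * d k"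
    and s: "\<And>k. 0 \<le> s k" "\<not> summable s"
  shows "d \<longlonglongrightarrow> 0"
proof (rule tendsto_sandwich[OF _ _ tendsto_const])
  have "filterlim (\<lambda>n. - (\<Sum>k<n. s k)) at_bot sequentially"
    using filterlim_sum_at_top_if_not_summable[OF s] by (simp add: filterlim_uminus_at_top)
  then have "(\<lambda>n. exp (- (\<Sum>k<n. s k))) \<longlonglongrightarrow> 0"
    by (rule filterlim_compose[OF exp_at_bot])
  then show "(\<lambda>n. exp (- (\<Sum>k<n. s k)) * d 0) \<longlonglongrightarrow> 0"
    by (rule tendsto_mult_left_zero)
qed (use nonneg contraction_le_exp_sum[of d s, OF nonneg step] in auto)

lemma averaging_le_tendsto_0:
  fixes a s \<epsilon> :: "nat \<Rightarrow> real"
  assumes nonneg: "\<And>k. 0 \<le> a k"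
    and s: "\<And>k. 0 \<le> s k" "\<And>k. s k \<le> 1" "\<not> summable s"
    and \<epsilon>: "\<epsilon> \<longlonglongrightarrow> 0"
    and step: "\<And>k. a (Suc k) \<le> (1 - s k) * a k + s k * \<epsilon> k"
  shows "a \<longlonglongrightarrow> 0"
proof (rule order_tendstoI)
  fix e :: real
  assume e: "0 < e"
  then have "\<forall>\<^sub>F k in sequentially. \<epsilon> k < e / 2" by (intro order_tendstoD(2)[OF \<epsilon>]) simp
  then obtain N where N: "\<And>k. k \<ge> N \<Longrightarrow> \<epsilon> k < e / 2" by (auto simp: eventually_sequentially)
  define d where "d k = max 0 (a (k + N) - e / 2)" for k
  have "d \<longlonglongrightarrow> 0"
  proof (rule contraction_tendsto_0)
    fix k
    have "a (Suc k + N) - e / 2 \<le> (1 - s (k + N)) * a (k + N) + s (k + N) * (e / 2) - e / 2"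
      using step[of "k + N"] mult_left_mono[OF less_imp_le[OF N] s(1), of "k + N" "k + N"] by simp
    also have "\<dots> = (1 - s (k + N)) * (a (k + N) - e / 2)" by (simp add: algebra_simps)
    also have "\<dots> \<le> (1 - s (k + N)) * d k"
      using s by (intro mult_left_mono) (auto simp: d_def)
    finally show "d (Suc k) \<le> (1 - s (k + N)) * d k"
      using s by (simp add: d_def)
  qed (use s in \<open>simp_all add: d_def\<close>)
  then have "\<forall>\<^sub>F k in sequentially. d k < e / 2" by (rule order_tendstoD(2)) (simp add: e)
  then have "\<forall>\<^sub>F k in sequentially. a (k + N) < e"
    by eventually_elim (use e in \<open>simp add: d_def max_def split: if_splits\<close>)
  then show "\<forall>\<^sub>F k in sequentially. a k < e"
    using eventually_sequentially_seg[of "\<lambda>k. a k < e" N] by blast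
qed (use nonneg in \<open>auto intro!: always_eventually intro: less_le_trans\<close>)

lemma averaging_tendsto:
  fixes h \<psi> :: "nat \<Rightarrow> 'a::real_normed_vector"
  assumes s: "\<And>k. 0 \<le> s k" "\<And>k. s k \<le> 1" "\<not> summable s"
    and \<psi>: "\<psi> \<longlonglongrightarrow> c"
    and step: "\<And>k. h (Suc k) = (1 - s k) *\<^sub>R h k + s k *\<^sub>R \<psi> k"
  shows "h \<longlonglongrightarrow> c"
proof -
  have "(\<lambda>k. norm (h k - c)) \<longlonglongrightarrow> 0"
  proof (rule averaging_le_tendsto_0[OF _ s])
    show "(\<lambda>k. norm (\<psi> k - c)) \<longlonglongrightarrow> 0"
      using \<psi> by (simp add: tendsto_norm_zero LIM_zero)
    fix k
    have "h (Suc k) - c = (1 - s k) *\<^sub>R (h k - c) + s k *\<^sub>R (\<psi> k - c)"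
      unfolding step by (simp add: algebra_simps)
    also have "norm \<dots> \<le> (1 - s k) * norm (h k - c) + s k * norm (\<psi> k - c)"
      using norm_triangle_ineq[of "(1 - s k) *\<^sub>R (h k - c)" "s k *\<^sub>R (\<psi> k - c)"] s by simp
    finally show "norm (h (Suc k) - c) \<le> (1 - s k) * norm (h k - c) + s k * norm (\<psi> k - c)" .
  qed simp
  then show ?thesis by (simp add: tendsto_norm_zero_iff LIM_zero_iff)
qed

lemma averaging_bounded:
  fixes h \<psi> :: "nat \<Rightarrow> 'a::real_normed_vector"
  assumes s: "\<And>k. 0 \<le> s k" "\<And>k. s k \<le> 1"
    and \<psi>: "bounded (range \<psi>)"
    and step: "\<And>k. h (Suc k) = (1 - s k) *\<^sub>R h k + s k *\<^sub>R \<psi> k"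
  shows "bounded (range h)"
proof -
  obtain C where C: "\<And>k. norm (\<psi> k) \<le> C" using \<psi> by (auto simp: bounded_iff)
  define M where "M = max C (norm (h 0))"
  have "norm (h k) \<le> M" for k
  proof (induction k)
    case (Suc k)
    have "norm (h (Suc k)) \<le> (1 - s k) * norm (h k) + s k * norm (\<psi> k)"
      unfolding step using norm_triangle_ineq[of "(1 - s k) *\<^sub>R h k" "s k *\<^sub>R \<psi> k"] s by simp
    also have "\<dots> \<le> (1 - s k) * M + s k * M"
      using s C Suc by (intro add_mono mult_left_mono) (auto simp: M_def le_max_iff_disj)
    finally show ?case by (simp add: algebra_simps)
  qed (simp add: M_def)
  then show ?thesis by (auto simp: bounded_iff)
qed

lemma tendsto_scaleR_null_bounded:
  fixes g :: "nat \<Rightarrow> 'a::real_normed_vector"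
  assumes "f \<longlonglongrightarrow> 0" and "bounded (range g)"
  shows "(\<lambda>k. f k *\<^sub>R g k) \<longlonglongrightarrow> 0"
proof -
  obtain C where "\<And>k. norm (g k) \<le> C" using assms(2) by (auto simp: bounded_iff)
  then show ?thesis by (intro lim_null_scaleR_bounded[OF assms(1), of g C]) simp
qed

section \<open>Subsequential limits\<close>

definition subsequential_limit :: "(nat \<Rightarrow> 'a::topological_space) \<Rightarrow> 'a \<Rightarrow> bool" where
  "subsequential_limit z p \<longleftrightarrow> (\<exists>r. strict_mono r \<and> (z \<circ> r) \<longlonglongrightarrow> p)"

lemma bounded_imp_subsequential_limit:
  fixes z :: "nat \<Rightarrow> 'a::heine_borel"
  assumes "bounded (range z)"
  obtains p where "subsequential_limit z p"
  using bounded_imp_convergent_subsequence[OF assms] by (auto simp: subsequential_limit_def)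

lemma subsequential_limit_of_subsequence:
  assumes "strict_mono r" and "subsequential_limit (z \<circ> r) p"
  shows "subsequential_limit z p"
  using assms by (metis subsequential_limit_def comp_assoc strict_mono_o)

lemma tendsto_subsequential_limit_unique:
  fixes z :: "nat \<Rightarrow> 'a::t2_space"
  assumes "z \<longlonglongrightarrow> p" and "subsequential_limit z q"
  shows "q = p"
  using assms LIMSEQ_subseq_LIMSEQ LIMSEQ_unique unfolding subsequential_limit_def by metis

lemma subsequential_limit_continuous_image:
  assumes "subsequential_limit z p" and "isCont F p"
  shows "subsequential_limit (\<lambda>k. F (z k)) (F p)"
  using assms isCont_tendsto_compose[OF assms(2)]
  by (fastforce simp: subsequential_limit_def o_def)

lemma continuous_image_tendsto_if_subsequential_limits:
  fixes z :: "nat \<Rightarrow> 'a::heine_borel" and F :: "'a \<Rightarrow> 'b::metric_space"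
  assumes bdd: "bounded (range z)" and cont: "continuous_on UNIV F"
    and limits: "\<And>p. subsequential_limit z p \<Longrightarrow> F p = c"
  shows "(\<lambda>k. F (z k)) \<longlonglongrightarrow> c"
proof (rule ccontr)
  assume "\<not> ?thesis"
  then obtain e where e: "0 < e" "\<And>N. \<exists>n\<ge>N. e \<le> dist (F (z n)) c"
    unfolding lim_sequentially by (auto simp: not_less)
  then have "infinite {n. e \<le> dist (F (z n)) c}"
    unfolding infinite_nat_iff_unbounded_le by blast
  then obtain r :: "nat \<Rightarrow> nat" where r: "strict_mono r" "\<And>n. e \<le> dist (F (z (r n))) c"
    using infinite_enumerate by (metis mem_Collect_eq)
  have "bounded (range (z \<circ> r))" by (rule bounded_subset[OF bdd]) auto
  then obtain p where p: "subsequential_limit (z \<circ> r) p" by (rule bounded_imp_subsequential_limit)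
  define D where "D q = dist (F q) c" for q
  have "isCont D p"
    unfolding D_def using cont
    by (intro continuous_intros) (simp add: continuous_on_eq_continuous_at)
  then have "subsequential_limit (\<lambda>k. D (z (r k))) (D p)"
    using subsequential_limit_continuous_image[OF p] by simp
  then have "e \<le> D p"
    unfolding subsequential_limit_def using r(2)
    by (auto simp: D_def intro: tendsto_lowerbound[OF _ always_eventually])
  moreover have "D p = 0"
    using limits[OF subsequential_limit_of_subsequence[OF r(1) p]] by (simp add: D_def)
  ultimately show False using e(1) by simp
qed

text \<open>Opial's principle, with a separating functional in place of the distance to a limit point.\<close>
lemma tendsto_if_subsequential_limits_separated:
  fixes z :: "nat \<Rightarrow> 'a::heine_borel"
  assumes bdd: "bounded (range z)"
    and separated: "\<And>p q. subsequential_limit z p \<Longrightarrow> subsequential_limit z q \<Longrightarrow> p \<noteq> q \<Longrightarrow>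
      \<exists>\<phi> :: 'a \<Rightarrow> real. continuous_on UNIV \<phi> \<and> convergent (\<lambda>k. \<phi> (z k)) \<and> \<phi> p \<noteq> \<phi> q"
  obtains p where "subsequential_limit z p" "z \<longlonglongrightarrow> p"
proof -
  obtain p where p: "subsequential_limit z p" using bdd by (rule bounded_imp_subsequential_limit)
  have "q = p" if q: "subsequential_limit z q" for q
  proof (rule ccontr)
    assume "q \<noteq> p"
    then obtain \<phi> :: "'a \<Rightarrow> real" and c where cont: "continuous_on UNIV \<phi>"
        and c: "(\<lambda>k. \<phi> (z k)) \<longlonglongrightarrow> c" and neq: "\<phi> p \<noteq> \<phi> q"
      using separated[OF p q] by (auto simp: convergent_def)
    have "\<phi> w = c" if "subsequential_limit z w" for w
      using tendsto_subsequential_limit_unique[OF c subsequential_limit_continuous_image[OF that]]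
        cont by (simp add: continuous_on_eq_continuous_at)
    then show False using p q neq by simp
  qed
  then have "z \<longlonglongrightarrow> p"
    using continuous_image_tendsto_if_subsequential_limits[OF bdd continuous_on_id] by blast
  with p show ?thesis by (rule that)
qed

section \<open>Inertial sequences\<close>

definition inertial :: "(nat \<Rightarrow> real) \<Rightarrow> (nat \<Rightarrow> 'a::real_vector) \<Rightarrow> nat \<Rightarrow> 'a" where
  "inertial \<tau> z k = z (Suc k) + ((\<tau> k - 1) / \<tau> (Suc k)) *\<^sub>R (z (Suc k) - z k)"

definition extrapolate :: "real \<Rightarrow> (nat \<Rightarrow> 'a::real_vector) \<Rightarrow> nat \<Rightarrow> 'a" where
  "extrapolate c z k = z k + c *\<^sub>R (z (Suc k) - z k)"

definition anchored :: "real \<Rightarrow> (nat \<Rightarrow> real) \<Rightarrow> (nat \<Rightarrow> 'a::real_vector) \<Rightarrow> 'a \<Rightarrow> nat \<Rightarrow> 'a" where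
  "anchored \<eta> \<tau> z p k = \<eta> *\<^sub>R (z (Suc k) - p) + (\<tau> k - 1) *\<^sub>R (z (Suc k) - z k)"

definition inertial_energy ::
  "real \<Rightarrow> (nat \<Rightarrow> real) \<Rightarrow> (nat \<Rightarrow> 'a::real_inner) \<Rightarrow> 'a \<Rightarrow> nat \<Rightarrow> real" where
  "inertial_energy \<eta> \<tau> z p k =
     (norm (anchored \<eta> \<tau> z p k))\<^sup>2 + \<eta> * (1 - \<eta>) * (norm (z (Suc k) - p))\<^sup>2"

lemma averaging_extrapolate:
  assumes "c \<noteq> 0"
  shows "z (Suc k) = (1 - 1 / c) *\<^sub>R z k + (1 / c) *\<^sub>R extrapolate c z k"
  using assms by (simp add: extrapolate_def algebra_simps)

lemma linear_extrapolate:
  assumes "linear F"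
  shows "F (extrapolate c z k) = extrapolate c (\<lambda>k. F (z k)) k"
  by (simp add: extrapolate_def linear_add[OF assms] linear_diff[OF assms] linear_cmul[OF assms])

lemma extrapolate_increment:
  assumes "\<tau> (Suc k) \<noteq> 0"
  shows "extrapolate (\<tau> (Suc k)) z (Suc k) - extrapolate (\<tau> k) z k =
    \<tau> (Suc k) *\<^sub>R (z (Suc (Suc k)) - inertial \<tau> z k)"
proof -
  have "\<tau> (Suc k) *\<^sub>R inertial \<tau> z k = \<tau> (Suc k) *\<^sub>R z (Suc k) + (\<tau> k - 1) *\<^sub>R (z (Suc k) - z k)"
    using assms by (simp add: inertial_def scaleR_add_right)
  then show ?thesis by (simp add: extrapolate_def algebra_simps)
qed

lemma anchored_eq_extrapolate:
  "anchored \<eta> \<tau> z p k = extrapolate (\<tau> k) z k - p - (1 - \<eta>) *\<^sub>R (z (Suc k) - p)"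
  by (simp add: anchored_def extrapolate_def algebra_simps)

lemma inertial_energy_increment:
  fixes z :: "nat \<Rightarrow> 'a::real_inner"
  assumes \<eta>: "\<eta> \<noteq> 0" and \<tau>: "\<tau> (Suc k) \<noteq> 0"
  defines "e \<equiv> z (Suc (Suc k)) - inertial \<tau> z k"
  shows "inertial_energy \<eta> \<tau> z p (Suc k) - inertial_energy \<eta> \<tau> z p k =
    2 * \<eta> * \<tau> (Suc k) * ((extrapolate (\<tau> (Suc k) / \<eta>) z (Suc k) - p) \<bullet> e)
    - (\<tau> (Suc k))\<^sup>2 * (norm e)\<^sup>2
    - (1 - \<eta>) * (2 * \<tau> (Suc k) - 1) * (norm (z (Suc (Suc k)) - z (Suc k)))\<^sup>2"
proof -
  define T where "T = \<tau> (Suc k)"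
  define d where "d = z (Suc (Suc k)) - z (Suc k)"
  define y where "y = z (Suc (Suc k)) - p"
  have z: "z (Suc k) - p = y - d" by (simp add: y_def d_def)
  have new: "anchored \<eta> \<tau> z p (Suc k) = \<eta> *\<^sub>R y + (T - 1) *\<^sub>R d"
    by (simp add: anchored_def y_def d_def T_def)
  have "anchored \<eta> \<tau> z p (Suc k) - anchored \<eta> \<tau> z p k = T *\<^sub>R e - (1 - \<eta>) *\<^sub>R d"
    using extrapolate_increment[of \<tau> k z, OF \<tau>] unfolding anchored_eq_extrapolate e_def d_def T_def
    by (simp add: algebra_simps)
  then have old: "anchored \<eta> \<tau> z p k = \<eta> *\<^sub>R y + (T - 1) *\<^sub>R d - (T *\<^sub>R e - (1 - \<eta>) *\<^sub>R d)"
    unfolding new by (simp add: algebra_simps)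
  have "extrapolate (T / \<eta>) z (Suc k) - p = y - d + (T / \<eta>) *\<^sub>R d"
    by (simp add: extrapolate_def y_def d_def)
  then have "\<eta> * ((extrapolate (T / \<eta>) z (Suc k) - p) \<bullet> e) = \<eta> * ((y - d) \<bullet> e) + T * (d \<bullet> e)"
    using \<eta> by (simp add: inner_add_left distrib_left)
  then have over: "2 * \<eta> * T * ((extrapolate (T / \<eta>) z (Suc k) - p) \<bullet> e)
      = 2 * T * (\<eta> * ((y - d) \<bullet> e) + T * (d \<bullet> e))"
    by simp
  show ?thesis
    unfolding inertial_energy_def new old z T_def[symmetric] over
    unfolding d_def[symmetric] y_def[symmetric] power2_norm_eq_inner
    by (simp add: inner_commute[of d y] inner_commute[of e y] inner_commute[of e d] power2_eq_square
        algebra_simps)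
qed

lemma inertial_energy_anchor_diff:
  fixes z :: "nat \<Rightarrow> 'a::real_inner"
  shows "inertial_energy \<eta> \<tau> z p k - inertial_energy \<eta> \<tau> z p' k =
    2 * \<eta> * ((p' - p) \<bullet> extrapolate (\<tau> k) z k) + \<eta> * ((norm p)\<^sup>2 - (norm p')\<^sup>2)"
  unfolding inertial_energy_def anchored_def extrapolate_def power2_norm_eq_inner
  by (simp add: inner_commute[of "z (Suc k)" p] inner_commute[of "z (Suc k)" p']
      inner_commute[of "z k" p] inner_commute[of "z k" p'] inner_commute[of "z k" "z (Suc k)"]
      algebra_simps)

text \<open>The index is shifted: \<open>\<tau> k\<close> is the parameter \<open>t\<^sub>k\<^sub>+\<^sub>1\<close>, so that no truncated subtraction
  occurs.\<close>
locale inertial_parameters =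
  fixes \<tau> :: "nat \<Rightarrow> real" and \<eta> :: real
  assumes \<tau>_0: "\<tau> 0 = 1"
    and \<tau>_mono: "\<And>k. \<tau> k \<le> \<tau> (Suc k)"
    and \<tau>_rate: "\<And>k. (\<tau> (Suc k))\<^sup>2 - (\<tau> k)\<^sup>2 \<le> \<eta> * \<tau> (Suc k)"
    and \<tau>_lim: "filterlim \<tau> at_top sequentially"
    and \<eta>_pos: "0 < \<eta>" and \<eta>_le_1: "\<eta> \<le> 1"
begin

abbreviation momentum :: "(nat \<Rightarrow> 'a::real_vector) \<Rightarrow> nat \<Rightarrow> 'a" where
  "momentum z k \<equiv> extrapolate (\<tau> k) z k"

text \<open>In the notation of the algorithm, \<open>overshoot x k\<close> is
  \<open>c\<^sub>k\<^sub>+\<^sub>1 x\<^sub>k\<^sub>+\<^sub>2 - \<alpha>\<^sub>k\<^sub>+\<^sub>1 x\<^sub>k\<^sub>+\<^sub>1\<close>.\<close>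
abbreviation overshoot :: "(nat \<Rightarrow> 'a::real_vector) \<Rightarrow> nat \<Rightarrow> 'a" where
  "overshoot z k \<equiv> extrapolate (\<tau> (Suc k) / \<eta>) z (Suc k)"

abbreviation residual :: "(nat \<Rightarrow> 'a::real_vector) \<Rightarrow> nat \<Rightarrow> 'a" where
  "residual z k \<equiv> z (Suc (Suc k)) - inertial \<tau> z k"

lemma \<tau>_ge_1: "1 \<le> \<tau> k"
  using lift_Suc_mono_le[of \<tau> 0 k] \<tau>_mono \<tau>_0 by simp

lemma \<tau>_pos: "0 < \<tau> k"
  using \<tau>_ge_1[of k] by linarith

lemma \<tau>_rate_product: "\<tau> (Suc k) * (\<tau> (Suc k) - \<eta>) \<le> (\<tau> k)\<^sup>2"
  using \<tau>_rate[of k] by (simp add: algebra_simps power2_eq_square)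

lemma \<tau>_le_linear: "\<tau> k \<le> real (Suc k)"
proof (induction k)
  case (Suc k)
  have "(\<tau> (Suc k) - \<tau> k) * \<tau> (Suc k) \<le> (\<tau> (Suc k) - \<tau> k) * (\<tau> (Suc k) + \<tau> k)"
    using \<tau>_mono[of k] \<tau>_pos[of k] by (intro mult_left_mono) auto
  also have "\<dots> \<le> \<eta> * \<tau> (Suc k)"
    using \<tau>_rate[of k] by (simp add: power2_eq_square algebra_simps)
  finally have "\<tau> (Suc k) - \<tau> k \<le> \<eta>" using \<tau>_pos[of "Suc k"] by simp
  then show ?case using Suc \<eta>_le_1 by simp
qed (simp add: \<tau>_0)

lemma not_summable_divide_\<tau>:
  assumes "c \<noteq> 0"
  shows "\<not> summable (\<lambda>k. c / \<tau> k)"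
proof
  assume "summable (\<lambda>k. c / \<tau> k)"
  from summable_mult[OF this, of "1 / c"] have "summable (\<lambda>k. 1 / \<tau> k)"
    using assms by simp
  then have "summable (\<lambda>k. inverse (real (Suc k)))"
    by (rule summable_comparison_test')
      (use \<tau>_le_linear \<tau>_pos in \<open>auto simp: divide_inverse intro!: le_imp_inverse_le\<close>)
  then show False using not_summable_harmonic[where 'a=real] by (subst (asm) summable_Suc_iff) simp
qed

lemma inverse_\<tau>_tendsto_0: "(\<lambda>k. 1 / \<tau> k) \<longlonglongrightarrow> 0"
  using tendsto_inverse_0_at_top[OF \<tau>_lim] by (simp add: inverse_eq_divide)

lemma inverse_\<tau>_square_tendsto_0: "(\<lambda>k. 1 / (\<tau> k)\<^sup>2) \<longlonglongrightarrow> 0"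
  using tendsto_power[OF inverse_\<tau>_tendsto_0, of 2] by (simp add: power_divide)

lemma residual_eq_momentum_increment:
  "residual z k = (1 / \<tau> (Suc k)) *\<^sub>R (momentum z (Suc k) - momentum z k)"
  using \<tau>_pos[of "Suc k"] by (simp add: extrapolate_increment)

lemma residual_tendsto_0:
  fixes z :: "nat \<Rightarrow> 'a::real_normed_vector"
  assumes "bounded (range (momentum z))"
  shows "residual z \<longlonglongrightarrow> 0"
proof -
  have "bounded (range (\<lambda>k. momentum z (Suc k)))"
    by (rule bounded_subset[OF assms]) auto
  then have "bounded (range (\<lambda>k. momentum z (Suc k) - momentum z k))"
    using assms by (rule bounded_minus_comp)
  from tendsto_scaleR_null_bounded[OF LIMSEQ_Suc[OF inverse_\<tau>_tendsto_0] this]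
  show ?thesis by (simp add: residual_eq_momentum_increment)
qed

lemma convergent_if_momentum_convergent:
  fixes a :: "nat \<Rightarrow> 'a::real_normed_vector"
  assumes "convergent (momentum a)"
  shows "convergent a"
proof -
  obtain c where c: "momentum a \<longlonglongrightarrow> c" using assms by (auto simp: convergent_def)
  have "a \<longlonglongrightarrow> c"
  proof (rule averaging_tendsto[OF _ _ _ c])
    show "a (Suc k) = (1 - 1 / \<tau> k) *\<^sub>R a k + (1 / \<tau> k) *\<^sub>R momentum a k" for k
      using \<tau>_pos[of k] by (intro averaging_extrapolate) simp
    show "0 \<le> 1 / \<tau> k" "1 / \<tau> k \<le> 1" for k using \<tau>_ge_1[of k] by auto
  qed (use not_summable_divide_\<tau>[of 1] in simp)
  then show ?thesis by (rule convergentI)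
qed

lemma inverse_\<tau>_square_averaging:
  obtains \<theta> where "\<theta> \<longlonglongrightarrow> 0"
    and "\<And>k. \<eta> / (\<tau> (Suc k))\<^sup>2 = (1 - \<eta> / \<tau> (Suc k)) * (\<eta> / (\<tau> k)\<^sup>2) + \<eta> / \<tau> (Suc k) * \<theta> k"
proof
  define \<theta> where "\<theta> k = (\<eta> * \<tau> (Suc k) - ((\<tau> (Suc k))\<^sup>2 - (\<tau> k)\<^sup>2)) / ((\<tau> k)\<^sup>2 * \<tau> (Suc k))" for k
  have nonneg: "0 \<le> \<theta> k" for k
    unfolding \<theta>_def using \<tau>_rate[of k] \<tau>_pos[of "Suc k"] by simp
  have upper: "\<theta> k \<le> \<eta> * (1 / (\<tau> k)\<^sup>2)" for k
  proof -
    have "\<theta> k \<le> (\<eta> * \<tau> (Suc k)) / ((\<tau> k)\<^sup>2 * \<tau> (Suc k))"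
      unfolding \<theta>_def using \<tau>_mono[of k] \<tau>_pos[of k] \<tau>_pos[of "Suc k"]
      by (intro divide_right_mono) (auto simp: power_mono)
    then show ?thesis using \<tau>_pos[of "Suc k"] by simp
  qed
  show "\<theta> \<longlonglongrightarrow> 0"
    using nonneg upper
    by (intro tendsto_sandwich[OF _ _ tendsto_const
          tendsto_mult_right_zero[OF inverse_\<tau>_square_tendsto_0, of \<eta>]] always_eventually) auto
  show "\<eta> / (\<tau> (Suc k))\<^sup>2 = (1 - \<eta> / \<tau> (Suc k)) * (\<eta> / (\<tau> k)\<^sup>2) + \<eta> / \<tau> (Suc k) * \<theta> k" for k
    unfolding \<theta>_def using \<tau>_pos[of k] \<tau>_pos[of "Suc k"]
    by (simp add: field_simps power2_eq_square)
qed

text \<open>The increments of \<open>D\<close> need not be summable against \<open>1 / \<tau>\<^sup>2\<close>. Subtracting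
  \<open>(\<eta> / (\<tau> k)\<^sup>2) *\<^sub>R D k\<close> from \<open>y (Suc k)\<close> turns them into a vanishing perturbation of the
  averaged values.\<close>
lemma tendsto_if_overshoot_perturbed:
  fixes y \<psi> D :: "nat \<Rightarrow> 'a::real_normed_vector"
  assumes D: "bounded (range D)" and \<psi>: "\<psi> \<longlonglongrightarrow> c"
    and overshoot: "\<And>k. overshoot y k = \<psi> k + (1 / \<tau> (Suc k)) *\<^sub>R (D (Suc k) - D k)"
  shows "y \<longlonglongrightarrow> c"
proof -
  define s where "s k = \<eta> / \<tau> (Suc k)" for k
  define g where "g k = y (Suc k) - (\<eta> / (\<tau> k)\<^sup>2) *\<^sub>R D k" for k
  obtain \<theta> where \<theta>: "\<theta> \<longlonglongrightarrow> 0"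
    and \<theta>_eq: "\<And>k. \<eta> / (\<tau> (Suc k))\<^sup>2 = (1 - s k) * (\<eta> / (\<tau> k)\<^sup>2) + s k * \<theta> k"
    using inverse_\<tau>_square_averaging unfolding s_def by blast
  have "g \<longlonglongrightarrow> c"
  proof (rule averaging_tendsto)
    show "0 \<le> s k" "s k \<le> 1" for k
      using \<tau>_ge_1[of "Suc k"] \<eta>_pos \<eta>_le_1 by (auto simp: s_def)
    show "\<not> summable s"
      unfolding s_def using not_summable_divide_\<tau>[of \<eta>] \<eta>_pos
      by (simp add: summable_Suc_iff[of "\<lambda>k. \<eta> / \<tau> k"])
    show "(\<lambda>k. \<psi> k - \<theta> k *\<^sub>R D k) \<longlonglongrightarrow> c"
      using tendsto_diff[OF \<psi> tendsto_scaleR_null_bounded[OF \<theta> D]] by simp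
    fix k
    have "y (Suc (Suc k)) = (1 - s k) *\<^sub>R y (Suc k) + s k *\<^sub>R overshoot y k"
      using averaging_extrapolate[of "\<tau> (Suc k) / \<eta>" y "Suc k"] \<tau>_pos[of "Suc k"] \<eta>_pos
      by (simp add: s_def)
    also have "s k *\<^sub>R overshoot y k
        = s k *\<^sub>R \<psi> k + (\<eta> / (\<tau> (Suc k))\<^sup>2) *\<^sub>R D (Suc k) - (\<eta> / (\<tau> (Suc k))\<^sup>2) *\<^sub>R D k"
      unfolding overshoot by (simp add: s_def algebra_simps power2_eq_square)
    finally have "g (Suc k) = (1 - s k) *\<^sub>R y (Suc k) + s k *\<^sub>R \<psi> k - (\<eta> / (\<tau> (Suc k))\<^sup>2) *\<^sub>R D k"
      by (simp add: g_def)
    then show "g (Suc k) = (1 - s k) *\<^sub>R g k + s k *\<^sub>R (\<psi> k - \<theta> k *\<^sub>R D k)"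
      unfolding \<theta>_eq g_def by (simp add: algebra_simps)
  qed
  moreover have "(\<lambda>k. (\<eta> / (\<tau> k)\<^sup>2) *\<^sub>R D k) \<longlonglongrightarrow> 0"
    using tendsto_scaleR_null_bounded
      [OF tendsto_mult_right_zero[OF inverse_\<tau>_square_tendsto_0] D, of \<eta>] by simp
  ultimately have "(\<lambda>k. g k + (\<eta> / (\<tau> k)\<^sup>2) *\<^sub>R D k) \<longlonglongrightarrow> c + 0" by (rule tendsto_add)
  then show ?thesis by (simp add: g_def LIMSEQ_imp_Suc)
qed

lemma inertial_energy_nonneg: "0 \<le> inertial_energy \<eta> \<tau> z p k"
  using \<eta>_pos \<eta>_le_1 by (simp add: inertial_energy_def)

lemma inertial_energy_increment_le:
  "inertial_energy \<eta> \<tau> z p (Suc k) - inertial_energy \<eta> \<tau> z p k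
    \<le> 2 * \<eta> * \<tau> (Suc k) * ((overshoot z k - p) \<bullet> residual z k)
      - (\<tau> (Suc k))\<^sup>2 * (norm (residual z k))\<^sup>2"
proof -
  have "0 \<le> (1 - \<eta>) * (2 * \<tau> (Suc k) - 1) * (norm (z (Suc (Suc k)) - z (Suc k)))\<^sup>2"
    using \<eta>_le_1 \<tau>_ge_1[of "Suc k"] by simp
  moreover have "\<eta> \<noteq> 0" "\<tau> (Suc k) \<noteq> 0" using \<eta>_pos \<tau>_pos[of "Suc k"] by auto
  ultimately show ?thesis by (simp add: inertial_energy_increment)
qed

lemma bounded_if_anchored_bounded:
  fixes z :: "nat \<Rightarrow> 'a::real_normed_vector"
  assumes anchored: "bounded (range (anchored \<eta> \<tau> z p))"
  shows "bounded (range z)"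
proof -
  define r where "r k = \<tau> k - 1 + \<eta>" for k
  have r: "0 < r k" "\<eta> \<le> r k" for k using \<tau>_ge_1[of k] \<eta>_pos by (auto simp: r_def)
  have "bounded (range (\<lambda>k. z k - p))"
  proof (rule averaging_bounded)
    fix k
    show "0 \<le> \<eta> / r k" "\<eta> / r k \<le> 1" using r[of k] \<eta>_pos by simp_all
    have "z (Suc k) - p = (1 / r k) *\<^sub>R (r k *\<^sub>R (z (Suc k) - p))" using r[of k] by simp
    also have "r k *\<^sub>R (z (Suc k) - p) = (r k - \<eta>) *\<^sub>R (z k - p) + anchored \<eta> \<tau> z p k"
      by (simp add: anchored_def r_def algebra_simps)
    finally show "z (Suc k) - p
        = (1 - \<eta> / r k) *\<^sub>R (z k - p) + (\<eta> / r k) *\<^sub>R ((1 / \<eta>) *\<^sub>R anchored \<eta> \<tau> z p k)"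
      using r[of k] \<eta>_pos by (simp add: scaleR_add_right diff_divide_distrib)
  qed (rule bounded_scaleR_comp[OF anchored])
  then have "bounded (range (\<lambda>k. (z k - p) + p))" by (intro bounded_plus_comp) simp_all
  then show ?thesis by simp
qed

lemma bounded_if_inertial_energy_bounded:
  assumes "\<And>k. inertial_energy \<eta> \<tau> z p k \<le> C"
  shows "bounded (range z)" and "bounded (range (momentum z))"
proof -
  have "norm (anchored \<eta> \<tau> z p k) \<le> sqrt C" for k
  proof (rule real_le_rsqrt)
    have "(norm (anchored \<eta> \<tau> z p k))\<^sup>2 \<le> inertial_energy \<eta> \<tau> z p k"
      using \<eta>_pos \<eta>_le_1 by (simp add: inertial_energy_def)
    then show "(norm (anchored \<eta> \<tau> z p k))\<^sup>2 \<le> C" using assms by (rule order_trans)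
  qed
  then have anchored: "bounded (range (anchored \<eta> \<tau> z p))" by (auto simp: bounded_iff)
  then show z: "bounded (range z)" by (rule bounded_if_anchored_bounded)
  have "bounded (range (\<lambda>k. z (Suc k)))" by (rule bounded_subset[OF z]) auto
  then have "bounded (range (\<lambda>k. anchored \<eta> \<tau> z p k + p + (1 - \<eta>) *\<^sub>R (z (Suc k) - p)))"
    using anchored by (intro bounded_plus_comp bounded_scaleR_comp bounded_minus_comp) simp_all
  then show "bounded (range (momentum z))" by (simp add: anchored_eq_extrapolate)
qed

end

lemma inertial_parameters_shift:
  fixes t :: "nat \<Rightarrow> real"
  assumes t: "t 1 = 1" "\<And>k. k \<ge> 1 \<Longrightarrow> t k \<le> t (k + 1)" "filterlim t at_top sequentially"
    and rate: "\<And>k. k \<ge> 1 \<Longrightarrow> (t (k + 1))\<^sup>2 - (t k)\<^sup>2 \<le> \<rho> * t (k + 1)"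
    and \<eta>: "0 < \<rho>" "\<rho> \<le> \<eta>" "\<eta> \<le> 1"
  shows "inertial_parameters (\<lambda>k. t (Suc k)) \<eta>"
proof
  show mono: "t (Suc k) \<le> t (Suc (Suc k))" for k using t(2)[of "Suc k"] by simp
  fix k
  have "1 \<le> t (Suc (Suc k))"
    using lift_Suc_mono_le[of "\<lambda>k. t (Suc k)" 0 "Suc k"] mono t(1) by simp
  then have "\<rho> * t (Suc (Suc k)) \<le> \<eta> * t (Suc (Suc k))" using \<eta> by (intro mult_right_mono) auto
  then show "(t (Suc (Suc k)))\<^sup>2 - (t (Suc k))\<^sup>2 \<le> \<eta> * t (Suc (Suc k))"
    using rate[of "Suc k"] by simp
qed (use t \<eta> filterlim_compose[OF t(3) filterlim_Suc] in auto)

section \<open>Linearly constrained convex programs\<close>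

definition kkt_points ::
  "('a::euclidean_space \<Rightarrow> 'b::euclidean_space) \<Rightarrow> 'b \<Rightarrow> ('a \<Rightarrow> 'a) \<Rightarrow> ('a \<times> 'b) set" where
  "kkt_points A b G = {(w, m). A w = b \<and> G w = - adjoint A m}"

locale linearly_constrained_convex_program =
  fixes F :: "'a::euclidean_space \<Rightarrow> real" and G :: "'a \<Rightarrow> 'a"
    and A :: "'a \<Rightarrow> 'b::euclidean_space" and b :: 'b
  assumes gradient: "\<And>w. (F has_derivative (\<lambda>h. G w \<bullet> h)) (at w)"
    and above_gradient: "\<And>w y. F w + G w \<bullet> (y - w) \<le> F y"
    and continuous_gradient: "continuous_on UNIV G"
    and linear_A: "linear A"
begin

definition lagrangian :: "'b \<Rightarrow> 'a \<Rightarrow> real" where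
  "lagrangian m y = F y + m \<bullet> (A y - b)"

lemma isCont_A: "isCont A w"
  using linear_A by (simp add: linear_linear linear_continuous_at)

lemma isCont_adjoint: "isCont (adjoint A) m"
  using adjoint_linear[OF linear_A] by (simp add: linear_linear linear_continuous_at)

lemma isCont_lagrangian: "isCont (lagrangian m) w"
  unfolding lagrangian_def
  using has_derivative_continuous[OF gradient] isCont_A by (intro continuous_intros)

lemma lagrangian_feasible: "A y = b \<Longrightarrow> lagrangian m y = F y"
  by (simp add: lagrangian_def)

lemma lagrangian_diff: "lagrangian m y - lagrangian m w = F y - F w + adjoint A m \<bullet> (y - w)"
  by (simp add: lagrangian_def adjoint_clauses[OF linear_A] linear_diff[OF linear_A]
      inner_diff_right)

lemma kkt_feasible: "(w, m) \<in> kkt_points A b G \<Longrightarrow> A w = b"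
  and kkt_stationary: "(w, m) \<in> kkt_points A b G \<Longrightarrow> G w = - adjoint A m"
  by (simp_all add: kkt_points_def)

lemma kkt_minimizes_lagrangian:
  assumes "(w, m) \<in> kkt_points A b G"
  shows "lagrangian m w \<le> lagrangian m y"
  using above_gradient[of w y] lagrangian_diff[of m y w] by (simp add: kkt_stationary[OF assms])

lemma lagrangian_minimizer_stationary:
  assumes kkt: "(w, m) \<in> kkt_points A b G" and le: "lagrangian m y \<le> lagrangian m w"
  shows "G y = - adjoint A m"
proof -
  have "(lagrangian m has_derivative (\<lambda>h. G y \<bullet> h + m \<bullet> (A h - 0))) (at y)"
    unfolding lagrangian_def
    by (intro has_derivative_add gradient has_derivative_inner_right has_derivative_diff
        has_derivative_const linear_imp_has_derivative linear_A)
  moreover have "\<forall>z\<in>UNIV. lagrangian m y \<le> lagrangian m z"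
    using kkt_minimizes_lagrangian[OF kkt] le by (auto intro: order_trans)
  ultimately have "(\<lambda>h. G y \<bullet> h + m \<bullet> (A h - 0)) = (\<lambda>h. 0)"
    by (intro differential_zero_maxmin[of y UNIV "lagrangian m"]) auto
  then have "(G y + adjoint A m) \<bullet> h = 0" for h
    by (simp add: inner_add_left adjoint_clauses[OF linear_A] fun_eq_iff)
  then show ?thesis by (metis eq_neg_iff_add_eq_0 inner_eq_zero_iff)
qed

text \<open>The gradient is constant on the solution set, so two multipliers differ by an element of the
  kernel of the adjoint of \<open>A\<close>.\<close>
lemma lagrangian_gap_unique:
  assumes kkt: "(w, m) \<in> kkt_points A b G" and kkt': "(w', m') \<in> kkt_points A b G"
  shows "lagrangian m y - lagrangian m w = lagrangian m' y - lagrangian m' w'"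
proof -
  have F_eq: "F w = F w'"
    using kkt_minimizes_lagrangian[OF kkt, of w'] kkt_minimizes_lagrangian[OF kkt', of w]
    by (simp add: lagrangian_feasible kkt_feasible[OF kkt] kkt_feasible[OF kkt'])
  then have "lagrangian m w' \<le> lagrangian m w"
    by (simp add: lagrangian_feasible kkt_feasible[OF kkt] kkt_feasible[OF kkt'])
  then have "adjoint A m = adjoint A m'"
    using lagrangian_minimizer_stationary[OF kkt] kkt_stationary[OF kkt'] by simp
  then have "lagrangian m y - lagrangian m w = lagrangian m' y - lagrangian m' w"
    by (simp add: lagrangian_diff)
  also have "lagrangian m' w = lagrangian m' w'"
    by (simp add: lagrangian_feasible kkt_feasible[OF kkt] kkt_feasible[OF kkt'] F_eq)
  finally show ?thesis .
qed

end

section \<open>Inertial primal-dual iterations\<close>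

text \<open>The vector \<open>v k\<close> is the gradient used in the primal step. In Case I it is \<open>G\<close> at the new
  iterate; in Case II the part of \<open>G\<close> that comes from the linearized objective is taken at the
  extrapolated point.\<close>
locale inertial_primal_dual =
  linearly_constrained_convex_program F G A b + inertial_parameters \<tau> \<eta>
  for F :: "'a::euclidean_space \<Rightarrow> real" and G and A :: "'a \<Rightarrow> 'b::euclidean_space" and b \<tau> \<eta> +
  fixes \<gamma> \<delta> \<Lambda> :: real and x v :: "nat \<Rightarrow> 'a" and l :: "nat \<Rightarrow> 'b"
  assumes \<gamma>_pos: "0 < \<gamma>" and \<delta>_pos: "0 < \<delta>"
    and primal_step: "\<And>k. residual x k = - \<gamma> *\<^sub>R (v k + adjoint A (overshoot l k))"
    and dual_step: "\<And>k. residual l k = \<delta> *\<^sub>R (A (overshoot x k) - b)"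
    and descent: "\<And>k y. F (x (Suc (Suc k))) - F y - (norm (residual x k))\<^sup>2 / (2 * \<gamma>)
        \<le> v k \<bullet> (x (Suc (Suc k)) - y)"
    and gradient_error: "\<And>k. norm (v k - G (x (Suc (Suc k)))) \<le> \<Lambda> * norm (residual x k)"
begin

definition energy :: "'a \<Rightarrow> 'b \<Rightarrow> nat \<Rightarrow> real" where
  "energy w m k = 2 * (\<tau> k)\<^sup>2 * (lagrangian m (x (Suc k)) - lagrangian m w)
     + inertial_energy \<eta> \<tau> x w k / \<gamma> + inertial_energy \<eta> \<tau> l m k / \<delta>"

lemma lagrangian_descent:
  "lagrangian m (x (Suc (Suc k))) - lagrangian m y - (norm (residual x k))\<^sup>2 / (2 * \<gamma>)
    \<le> (v k + adjoint A m) \<bullet> (x (Suc (Suc k)) - y)"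
  using descent[of k y] by (simp add: lagrangian_diff inner_add_left)

lemma primal_dual_coupling:
  assumes "A w = b"
  shows "(overshoot x k - w) \<bullet> residual x k / \<gamma> + (overshoot l k - m) \<bullet> (A (overshoot x k) - b)
    = - ((v k + adjoint A m) \<bullet> (overshoot x k - w))"
proof -
  have "A (overshoot x k) - b = A (overshoot x k - w)"
    by (simp add: linear_diff[OF linear_A] assms)
  moreover have "(overshoot x k - w) \<bullet> residual x k / \<gamma>
      = - ((v k + adjoint A (overshoot l k)) \<bullet> (overshoot x k - w))"
    unfolding primal_step using \<gamma>_pos by (simp add: inner_commute)
  ultimately show ?thesis
    by (simp add: inner_add_left inner_diff_left adjoint_clauses[OF linear_A])
qed

lemma lagrangian_descent_overshoot:
  defines "R \<equiv> \<lambda>k. (norm (residual x k))\<^sup>2 / (2 * \<gamma>)"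
  shows "(\<tau> (Suc k) / \<eta>) * (lagrangian m (x (Suc (Suc k))) - lagrangian m w - R k)
      - (\<tau> (Suc k) / \<eta> - 1) * (lagrangian m (x (Suc k)) - lagrangian m w)
    \<le> (v k + adjoint A m) \<bullet> (overshoot x k - w)"
proof -
  define c where "c = \<tau> (Suc k) / \<eta>"
  define u where "u = v k + adjoint A m"
  define P where "P j = lagrangian m (x j) - lagrangian m w" for j
  let ?X = "x (Suc (Suc k))"
  have c: "1 \<le> c" using \<tau>_ge_1[of "Suc k"] \<eta>_pos \<eta>_le_1 by (simp add: c_def)
  have step: "lagrangian m ?X - lagrangian m y - R k \<le> u \<bullet> (?X - y)" for y
    using lagrangian_descent[of m k y] by (simp add: u_def R_def)
  have "c * (P (Suc (Suc k)) - R k) - (c - 1) * P (Suc k)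
      = (P (Suc (Suc k)) - R k) + (c - 1) * (P (Suc (Suc k)) - P (Suc k) - R k)"
    by (simp add: algebra_simps)
  also have "\<dots> \<le> u \<bullet> (?X - w) + (c - 1) * (u \<bullet> (?X - x (Suc k)))"
    using c step[of w] step[of "x (Suc k)"]
    by (intro add_mono mult_left_mono) (simp_all add: P_def)
  also have "\<dots> = u \<bullet> (overshoot x k - w)"
    by (simp add: extrapolate_def c_def[symmetric] algebra_simps)
  finally show ?thesis unfolding c_def u_def P_def .
qed

lemma gap_increment_le:
  assumes kkt: "(w, m) \<in> kkt_points A b G"
  shows "2 * (\<tau> (Suc k))\<^sup>2 * (lagrangian m (x (Suc (Suc k))) - lagrangian m w)
      - 2 * (\<tau> k)\<^sup>2 * (lagrangian m (x (Suc k)) - lagrangian m w)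
    \<le> 2 * \<eta> * \<tau> (Suc k) * ((v k + adjoint A m) \<bullet> (overshoot x k - w))
      + (\<tau> (Suc k))\<^sup>2 * (norm (residual x k))\<^sup>2 / \<gamma>"
proof -
  define T where "T = \<tau> (Suc k)"
  define R where "R = (norm (residual x k))\<^sup>2 / (2 * \<gamma>)"
  define P where "P j = lagrangian m (x j) - lagrangian m w" for j
  have "T * (T - \<eta>) * P (Suc k) \<le> (\<tau> k)\<^sup>2 * P (Suc k)"
    unfolding T_def P_def using kkt_minimizes_lagrangian[OF kkt]
    by (intro mult_right_mono \<tau>_rate_product) simp
  then have "2 * T\<^sup>2 * P (Suc (Suc k)) - 2 * (\<tau> k)\<^sup>2 * P (Suc k)
      \<le> 2 * T\<^sup>2 * P (Suc (Suc k)) - 2 * (T * (T - \<eta>) * P (Suc k))"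
    by simp
  also have "\<dots> = 2 * \<eta> * T * ((T / \<eta>) * (P (Suc (Suc k)) - R) - (T / \<eta> - 1) * P (Suc k))
      + 2 * T\<^sup>2 * R"
    using \<eta>_pos by (simp add: field_simps power2_eq_square)
  also have "\<dots> \<le> 2 * \<eta> * T * ((v k + adjoint A m) \<bullet> (overshoot x k - w)) + 2 * T\<^sup>2 * R"
    using lagrangian_descent_overshoot[of k m w] \<eta>_pos \<tau>_pos[of "Suc k"]
    by (intro add_right_mono mult_left_mono) (simp_all add: T_def R_def P_def)
  finally show ?thesis by (simp add: T_def R_def P_def)
qed

lemma energy_decreasing:
  assumes kkt: "(w, m) \<in> kkt_points A b G"
  shows "energy w m (Suc k) \<le> energy w m k"
proof -
  define c where "c = 2 * \<eta> * \<tau> (Suc k)"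
  have "(inertial_energy \<eta> \<tau> x w (Suc k) - inertial_energy \<eta> \<tau> x w k) / \<gamma>
      \<le> (c * ((overshoot x k - w) \<bullet> residual x k)
        - (\<tau> (Suc k))\<^sup>2 * (norm (residual x k))\<^sup>2) / \<gamma>"
    unfolding c_def using \<gamma>_pos by (intro divide_right_mono inertial_energy_increment_le) auto
  then have primal: "inertial_energy \<eta> \<tau> x w (Suc k) / \<gamma> - inertial_energy \<eta> \<tau> x w k / \<gamma>
      \<le> c * ((overshoot x k - w) \<bullet> residual x k / \<gamma>)
        - (\<tau> (Suc k))\<^sup>2 * (norm (residual x k))\<^sup>2 / \<gamma>"
    by (simp add: diff_divide_distrib)
  have "inertial_energy \<eta> \<tau> l m (Suc k) - inertial_energy \<eta> \<tau> l m k
      \<le> c * ((overshoot l k - m) \<bullet> residual l k)"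
    unfolding c_def
    by (rule order_trans[OF inertial_energy_increment_le]) simp
  then have "(inertial_energy \<eta> \<tau> l m (Suc k) - inertial_energy \<eta> \<tau> l m k) / \<delta>
      \<le> c * ((overshoot l k - m) \<bullet> residual l k) / \<delta>"
    using \<delta>_pos by (intro divide_right_mono) auto
  then have dual: "inertial_energy \<eta> \<tau> l m (Suc k) / \<delta> - inertial_energy \<eta> \<tau> l m k / \<delta>
      \<le> c * ((overshoot l k - m) \<bullet> (A (overshoot x k) - b))"
    unfolding dual_step using \<delta>_pos by (simp add: diff_divide_distrib)
  have "c * ((overshoot x k - w) \<bullet> residual x k / \<gamma>)
      + c * ((overshoot l k - m) \<bullet> (A (overshoot x k) - b))
    = - (c * ((v k + adjoint A m) \<bullet> (overshoot x k - w)))"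
    unfolding distrib_left[symmetric] primal_dual_coupling[OF kkt_feasible[OF kkt]] by simp
  then show ?thesis
    using primal dual gap_increment_le[OF kkt, of k] unfolding energy_def c_def[symmetric]
    by linarith
qed

lemma energy_components_le:
  assumes kkt: "(w, m) \<in> kkt_points A b G"
  shows "2 * (\<tau> k)\<^sup>2 * (lagrangian m (x (Suc k)) - lagrangian m w) \<le> energy w m 0"
    and "inertial_energy \<eta> \<tau> x w k \<le> \<gamma> * energy w m 0"
    and "inertial_energy \<eta> \<tau> l m k \<le> \<delta> * energy w m 0"
    and "0 \<le> energy w m k"
proof -
  have gap: "0 \<le> 2 * (\<tau> k)\<^sup>2 * (lagrangian m (x (Suc k)) - lagrangian m w)"
    using kkt_minimizes_lagrangian[OF kkt, of "x (Suc k)"] by simp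
  have inertia: "0 \<le> inertial_energy \<eta> \<tau> x w k / \<gamma>" "0 \<le> inertial_energy \<eta> \<tau> l m k / \<delta>"
    using \<gamma>_pos \<delta>_pos by (simp_all add: inertial_energy_nonneg)
  show "0 \<le> energy w m k" unfolding energy_def using gap inertia by linarith
  have total: "energy w m k \<le> energy w m 0"
    using lift_Suc_antimono_le[of "energy w m" 0 k] energy_decreasing[OF kkt] by simp
  then show "2 * (\<tau> k)\<^sup>2 * (lagrangian m (x (Suc k)) - lagrangian m w) \<le> energy w m 0"
    using gap inertia unfolding energy_def[of w m k] by linarith
  have "inertial_energy \<eta> \<tau> x w k / \<gamma> \<le> energy w m 0"
    "inertial_energy \<eta> \<tau> l m k / \<delta> \<le> energy w m 0"
    using total gap inertia unfolding energy_def[of w m k] by linarith+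
  then show "inertial_energy \<eta> \<tau> x w k \<le> \<gamma> * energy w m 0"
    "inertial_energy \<eta> \<tau> l m k \<le> \<delta> * energy w m 0"
    using \<gamma>_pos \<delta>_pos by (simp_all add: pos_divide_le_eq mult.commute)
qed

lemma convergent_energy:
  assumes "(w, m) \<in> kkt_points A b G"
  shows "convergent (energy w m)"
proof (rule convergentI[OF LIMSEQ_decseq_INF])
  show "bdd_below (range (energy w m))"
    using energy_components_le(4)[OF assms] by (intro bdd_belowI[of _ 0]) auto
  show "decseq (energy w m)" by (simp add: decseq_Suc_iff energy_decreasing[OF assms])
qed

lemma momentum_functional_convergent:
  assumes kkt: "(w, m) \<in> kkt_points A b G" and kkt': "(w', m') \<in> kkt_points A b G"
  shows "convergent (momentum (\<lambda>k. (w' - w) \<bullet> x k / \<gamma> + (m' - m) \<bullet> l k / \<delta>))"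
proof -
  define a where "a k = (w' - w) \<bullet> x k / \<gamma> + (m' - m) \<bullet> l k / \<delta>" for k
  define K where "K = \<eta> * ((norm w)\<^sup>2 - (norm w')\<^sup>2) / \<gamma> + \<eta> * ((norm m)\<^sup>2 - (norm m')\<^sup>2) / \<delta>"
  have "momentum a k = (energy w m k - energy w' m' k - K) * (1 / (2 * \<eta>))" for k
  proof -
    have "momentum a k = (w' - w) \<bullet> momentum x k / \<gamma> + (m' - m) \<bullet> momentum l k / \<delta>"
      by (simp add: a_def extrapolate_def add_divide_distrib diff_divide_distrib algebra_simps)
    moreover have "energy w m k - energy w' m' k =
        (inertial_energy \<eta> \<tau> x w k - inertial_energy \<eta> \<tau> x w' k) / \<gamma>
        + (inertial_energy \<eta> \<tau> l m k - inertial_energy \<eta> \<tau> l m' k) / \<delta>"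
      unfolding energy_def lagrangian_gap_unique[OF kkt kkt'] diff_divide_distrib by simp
    ultimately have "energy w m k - energy w' m' k = 2 * \<eta> * momentum a k + K"
      unfolding inertial_energy_anchor_diff K_def
      by (simp only: add_divide_distrib distrib_left) simp
    then show ?thesis using \<eta>_pos by simp
  qed
  moreover have "convergent (\<lambda>k. (energy w m k - energy w' m' k - K) * (1 / (2 * \<eta>)))"
    by (intro convergent_mult convergent_diff convergent_const convergent_energy kkt kkt')
  ultimately show ?thesis unfolding a_def by simp
qed

context
  fixes w :: 'a and m :: 'b
  assumes kkt: "(w, m) \<in> kkt_points A b G"
begin

lemmas bounded_primal = bounded_if_inertial_energy_bounded[OF energy_components_le(2)[OF kkt]]
lemmas bounded_dual = bounded_if_inertial_energy_bounded[OF energy_components_le(3)[OF kkt]]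

lemma lagrangian_tendsto: "(\<lambda>k. lagrangian m (x k)) \<longlonglongrightarrow> lagrangian m w"
proof -
  have upper: "lagrangian m (x (Suc k)) - lagrangian m w \<le> energy w m 0 / 2 * (1 / (\<tau> k)\<^sup>2)" for k
    using energy_components_le(1)[OF kkt, of k] \<tau>_pos[of k] by (simp add: field_simps)
  have "(\<lambda>k. lagrangian m (x (Suc k)) - lagrangian m w) \<longlonglongrightarrow> 0"
    using kkt_minimizes_lagrangian[OF kkt] upper
    by (intro tendsto_sandwich[OF _ _ tendsto_const
          tendsto_mult_right_zero[OF inverse_\<tau>_square_tendsto_0, of "energy w m 0 / 2"]]
        always_eventually) auto
  then show ?thesis by (simp add: LIM_zero_iff LIMSEQ_imp_Suc)
qed

lemma feasibility_tendsto: "(\<lambda>k. A (x k)) \<longlonglongrightarrow> b"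
proof (rule tendsto_if_overshoot_perturbed[OF _ tendsto_const])
  show "bounded (range (\<lambda>k. (1 / \<delta>) *\<^sub>R momentum l k))"
    by (intro bounded_scaleR_comp bounded_dual(2))
  fix k
  have "A (overshoot x k) = b + (1 / \<delta>) *\<^sub>R residual l k"
    unfolding dual_step using \<delta>_pos by simp
  then show "overshoot (\<lambda>k. A (x k)) k
      = b + (1 / \<tau> (Suc k)) *\<^sub>R ((1 / \<delta>) *\<^sub>R momentum l (Suc k) - (1 / \<delta>) *\<^sub>R momentum l k)"
    unfolding residual_eq_momentum_increment linear_extrapolate[OF linear_A]
    by (simp add: algebra_simps)
qed

lemma primal_limit_optimal:
  assumes p: "subsequential_limit x p"
  shows "A p = b" and "G p = - adjoint A m"
proof -
  show "A p = b"
    using tendsto_subsequential_limit_unique[OF feasibility_tendsto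
        subsequential_limit_continuous_image[OF p isCont_A]] .
  have "lagrangian m p = lagrangian m w"
    using tendsto_subsequential_limit_unique[OF lagrangian_tendsto
        subsequential_limit_continuous_image[OF p isCont_lagrangian]] .
  then show "G p = - adjoint A m" by (simp add: lagrangian_minimizer_stationary[OF kkt])
qed

lemma gradient_tendsto: "v \<longlonglongrightarrow> - adjoint A m"
proof -
  have "(\<lambda>k. G (x k)) \<longlonglongrightarrow> - adjoint A m"
    using continuous_image_tendsto_if_subsequential_limits[OF bounded_primal(1) continuous_gradient]
      primal_limit_optimal(2) by blast
  then have "(\<lambda>k. G (x (Suc (Suc k)))) \<longlonglongrightarrow> - adjoint A m" by (intro LIMSEQ_Suc)
  moreover have "(\<lambda>k. v k - G (x (Suc (Suc k)))) \<longlonglongrightarrow> 0"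
  proof (rule Lim_null_comparison)
    show "(\<lambda>k. \<Lambda> * norm (residual x k)) \<longlonglongrightarrow> 0"
      by (intro tendsto_mult_right_zero tendsto_norm_zero residual_tendsto_0 bounded_primal(2))
  qed (simp add: gradient_error)
  ultimately have "(\<lambda>k. G (x (Suc (Suc k))) + (v k - G (x (Suc (Suc k))))) \<longlonglongrightarrow> - adjoint A m + 0"
    by (rule tendsto_add)
  then show ?thesis by simp
qed

lemma adjoint_dual_tendsto: "(\<lambda>k. adjoint A (l k)) \<longlonglongrightarrow> adjoint A m"
proof (rule tendsto_if_overshoot_perturbed)
  show "bounded (range (\<lambda>k. (- 1 / \<gamma>) *\<^sub>R momentum x k))"
    by (intro bounded_scaleR_comp bounded_primal(2))
  show "(\<lambda>k. - v k) \<longlonglongrightarrow> adjoint A m"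
    using tendsto_minus[OF gradient_tendsto] by simp
  fix k
  have "adjoint A (overshoot l k) = - v k + (- 1 / \<gamma>) *\<^sub>R residual x k"
    unfolding primal_step using \<gamma>_pos by simp
  then show "overshoot (\<lambda>k. adjoint A (l k)) k = - v k
      + (1 / \<tau> (Suc k)) *\<^sub>R ((- 1 / \<gamma>) *\<^sub>R momentum x (Suc k) - (- 1 / \<gamma>) *\<^sub>R momentum x k)"
    unfolding residual_eq_momentum_increment linear_extrapolate[OF adjoint_linear[OF linear_A]]
    by (simp add: algebra_simps)
qed

lemma subsequential_limit_kkt:
  assumes limit: "subsequential_limit (\<lambda>k. (x k, l k)) (p, q)"
  shows "(p, q) \<in> kkt_points A b G"
proof -
  have "isCont fst (p, q)" and "isCont snd (p, q)"
    by (auto intro: continuous_fst continuous_snd continuous_ident)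
  then have p: "subsequential_limit x p" and q: "subsequential_limit l q"
    using subsequential_limit_continuous_image[OF limit] by fastforce+
  have "adjoint A q = adjoint A m"
    using tendsto_subsequential_limit_unique[OF adjoint_dual_tendsto
        subsequential_limit_continuous_image[OF q isCont_adjoint]] .
  then show ?thesis using primal_limit_optimal[OF p] by (simp add: kkt_points_def)
qed

end

lemma kkt_points_separated:
  assumes "p \<in> kkt_points A b G" and "p' \<in> kkt_points A b G" and neq: "p \<noteq> p'"
  shows "\<exists>\<phi> :: 'a \<times> 'b \<Rightarrow> real.
    continuous_on UNIV \<phi> \<and> convergent (\<lambda>k. \<phi> (x k, l k)) \<and> \<phi> p \<noteq> \<phi> p'"
proof (intro exI conjI)
  define d where "d = p' - p"
  define \<phi> where "\<phi> y = fst d \<bullet> fst y / \<gamma> + snd d \<bullet> snd y / \<delta>" for y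
  show "continuous_on UNIV \<phi>"
    unfolding \<phi>_def using \<gamma>_pos \<delta>_pos by (intro continuous_intros) auto
  have "convergent (momentum (\<lambda>k. \<phi> (x k, l k)))"
    using momentum_functional_convergent[of "fst p" "snd p" "fst p'" "snd p'"] assms(1,2)
    by (simp add: \<phi>_def d_def)
  then show "convergent (\<lambda>k. \<phi> (x k, l k))" by (rule convergent_if_momentum_convergent)
  show "\<phi> p \<noteq> \<phi> p'"
  proof
    assume "\<phi> p = \<phi> p'"
    then have "(norm (fst d))\<^sup>2 / \<gamma> + (norm (snd d))\<^sup>2 / \<delta> = 0"
      by (simp add: \<phi>_def d_def power2_norm_eq_inner inner_diff_right diff_divide_distrib)
    then have "fst d = 0 \<and> snd d = 0"
      using \<gamma>_pos \<delta>_pos by (subst (asm) add_nonneg_eq_0_iff) auto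
    then show False using neq by (simp add: d_def prod_eq_iff)
  qed
qed

theorem iterates_converge:
  assumes "kkt_points A b G \<noteq> {}"
  obtains p q where "(p, q) \<in> kkt_points A b G" "x \<longlonglongrightarrow> p" "l \<longlonglongrightarrow> q"
proof -
  let ?z = "\<lambda>k. (x k, l k)"
  obtain w m where kkt: "(w, m) \<in> kkt_points A b G" using assms by auto
  have bounded: "bounded (range ?z)"
    using bounded_Times[OF bounded_primal(1)[OF kkt] bounded_dual(1)[OF kkt]]
    by (rule bounded_subset) auto
  have limit_kkt: "p \<in> kkt_points A b G" if "subsequential_limit ?z p" for p
    using subsequential_limit_kkt[OF kkt, of "fst p" "snd p"] that by simp
  obtain p where p: "subsequential_limit ?z p" "?z \<longlonglongrightarrow> p"
    using tendsto_if_subsequential_limits_separated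
      [OF bounded kkt_points_separated[OF limit_kkt limit_kkt]] by blast
  show ?thesis
    using limit_kkt[OF p(1)] tendsto_fst[OF p(2)] tendsto_snd[OF p(2)]
    by (intro that[of "fst p" "snd p"]) simp_all
qed

end

section \<open>The accelerated augmented Lagrangian method\<close>

definition penalty :: "('a \<Rightarrow> 'b::real_inner) \<Rightarrow> 'b \<Rightarrow> real \<Rightarrow> 'a \<Rightarrow> real" where
  "penalty A b \<beta> y = \<beta> / 2 * (norm (A y - b))\<^sup>2"

definition penalty_gradient ::
  "('a::euclidean_space \<Rightarrow> 'b::euclidean_space) \<Rightarrow> 'b \<Rightarrow> real \<Rightarrow> 'a \<Rightarrow> 'a" where
  "penalty_gradient A b \<beta> y = \<beta> *\<^sub>R adjoint A (A y - b)"

lemma has_derivative_penalty: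
  fixes A :: "'a::euclidean_space \<Rightarrow> 'b::euclidean_space"
  assumes "linear A"
  shows "(penalty A b \<beta> has_derivative (\<lambda>h. \<beta> * ((A y - b) \<bullet> A h))) (at y)"
proof -
  have "((\<lambda>y. A y - b) has_derivative (\<lambda>h. A h - 0)) (at y)"
    by (intro has_derivative_diff has_derivative_const linear_imp_has_derivative assms)
  from has_derivative_mult_right[OF has_derivative_inner[OF this this], of "\<beta> / 2"] show ?thesis
    by (simp add: penalty_def[abs_def] power2_norm_eq_inner inner_commute)
qed

lemma penalty_gradient_inner:
  assumes "linear A"
  shows "penalty_gradient A b \<beta> y \<bullet> h = \<beta> * ((A y - b) \<bullet> A h)"
  by (simp add: penalty_gradient_def adjoint_clauses[OF assms])

lemma has_derivative_add_penalty:
  fixes A :: "'a::euclidean_space \<Rightarrow> 'b::euclidean_space"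
  assumes "linear A" and "(f has_derivative (\<lambda>h. s \<bullet> h)) (at y)"
  shows "((\<lambda>y. f y + penalty A b \<beta> y) has_derivative
    (\<lambda>h. (s + penalty_gradient A b \<beta> y) \<bullet> h)) (at y)"
  unfolding inner_add_left penalty_gradient_inner[OF assms(1)]
  by (intro has_derivative_add has_derivative_penalty assms)

lemma penalty_above_gradient:
  assumes "linear A" and "0 \<le> \<beta>"
  shows "penalty A b \<beta> w + penalty_gradient A b \<beta> w \<bullet> (y - w) \<le> penalty A b \<beta> y"
proof -
  define g h where "g = A w - b" and "h = A (y - w)"
  have "A y - b = g + h" by (simp add: g_def h_def linear_diff[OF assms(1)])
  then have "penalty A b \<beta> y
      = penalty A b \<beta> w + penalty_gradient A b \<beta> w \<bullet> (y - w) + \<beta> / 2 * (norm h)\<^sup>2"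
    unfolding penalty_gradient_inner[OF assms(1)] penalty_def power2_norm_eq_inner
      g_def[symmetric] h_def[symmetric]
    by (simp add: inner_commute[of h g] algebra_simps)
  then show ?thesis using assms(2) by simp
qed

lemma continuous_on_penalty_gradient:
  assumes "linear A"
  shows "continuous_on S (penalty_gradient A b \<beta>)"
  unfolding penalty_gradient_def
  by (intro continuous_intros linear_continuous_on_compose[OF _ adjoint_linear[OF assms]]
      linear_continuous_on_compose[OF continuous_on_id assms])

lemma kkt_points_penalty:
  assumes "linear A"
  shows "kkt_points A b (\<lambda>y. g y + penalty_gradient A b \<beta> y) = kkt_points A b g"
  by (auto simp: kkt_points_def penalty_gradient_def linear_0[OF adjoint_linear[OF assms]])

lemma kkt_set_eq_kkt_points: "kkt_set A b g = kkt_points ((*v) A) b g"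
  by (auto simp: kkt_set_def kkt_points_def adjoint_matrix eq_neg_iff_add_eq_0)

lemma aalm_obj_minimizer_stationary:
  fixes A :: "real^'n^'m"
  assumes g: "(g has_derivative (\<lambda>h. s \<bullet> h)) (at y)"
    and min: "\<And>y'. aalm_obj g A b \<beta> \<gamma> \<delta> xb p c r y \<le> aalm_obj g A b \<beta> \<gamma> \<delta> xb p c r y'"
  shows "s + penalty_gradient ((*v) A) b \<beta> y + (1 / \<gamma>) *\<^sub>R (y - xb)
    + adjoint ((*v) A) (p + c *\<^sub>R \<delta> *\<^sub>R (c *\<^sub>R (A *v y) - r)) = 0" (is "?w = 0")
proof -
  have obj: "aalm_obj g A b \<beta> \<gamma> \<delta> xb p c r = (\<lambda>y. g y + penalty ((*v) A) b \<beta> y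
      + penalty (\<lambda>y. y) xb (1 / \<gamma>) y + p \<bullet> (A *v y - b) + penalty (\<lambda>y. c *\<^sub>R (A *v y)) r \<delta> y)"
    by (simp add: aalm_obj_def penalty_def fun_eq_iff)
  have scaled: "linear (\<lambda>y. c *\<^sub>R (A *v y))"
    by (intro linear_compose_scale_right matrix_vector_mul_linear)
  have "(aalm_obj g A b \<beta> \<gamma> \<delta> xb p c r has_derivative
      (\<lambda>h. (s + penalty_gradient ((*v) A) b \<beta> y) \<bullet> h + 1 / \<gamma> * ((y - xb) \<bullet> h)
        + p \<bullet> (A *v h - 0) + \<delta> * ((c *\<^sub>R (A *v y) - r) \<bullet> (c *\<^sub>R (A *v h))))) (at y)"
    unfolding obj
    by (intro has_derivative_add has_derivative_add_penalty g has_derivative_penalty scaled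
        has_derivative_inner_right has_derivative_diff has_derivative_const
        linear_imp_has_derivative matrix_vector_mul_linear linear_ident)
  from differential_zero_maxmin[OF UNIV_I open_UNIV this] min
  have "(s + penalty_gradient ((*v) A) b \<beta> y) \<bullet> h + 1 / \<gamma> * ((y - xb) \<bullet> h)
      + p \<bullet> (A *v h - 0) + \<delta> * ((c *\<^sub>R (A *v y) - r) \<bullet> (c *\<^sub>R (A *v h))) = 0" for h
    by (simp add: fun_eq_iff)
  then have "?w \<bullet> h = 0" for h
    by (simp add: inner_add_left adjoint_clauses[OF matrix_vector_mul_linear] mult_ac add_ac)
  then show ?thesis using inner_eq_zero_iff by blast
qed

locale accelerated_augmented_lagrangian = inertial_parameters "\<lambda>k. t (Suc k)" \<eta>
  for t :: "nat \<Rightarrow> real" and \<eta> :: real +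
  fixes f :: "real^'n \<Rightarrow> real" and grad_f :: "real^'n \<Rightarrow> real^'n"
    and A :: "real^'n^'m" and b :: "real^'m" and \<gamma> \<delta> \<beta> :: real
  assumes f_convex: "convex_on UNIV f"
    and f_grad: "\<And>z. (f has_derivative (\<lambda>h. grad_f z \<bullet> h)) (at z)"
    and f_C1: "continuous_on UNIV grad_f"
    and \<gamma>_pos: "0 < \<gamma>" and \<delta>_pos: "0 < \<delta>" and \<beta>_nonneg: "0 \<le> \<beta>"
begin

sublocale program: linearly_constrained_convex_program
  "\<lambda>y. f y + penalty ((*v) A) b \<beta> y" "\<lambda>y. grad_f y + penalty_gradient ((*v) A) b \<beta> y" "(*v) A" b
proof
  show "((\<lambda>y. f y + penalty ((*v) A) b \<beta> y) has_derivative
      (\<lambda>h. (grad_f w + penalty_gradient ((*v) A) b \<beta> w) \<bullet> h)) (at w)" for w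
    by (intro has_derivative_add_penalty f_grad matrix_vector_mul_linear)
  show "f w + penalty ((*v) A) b \<beta> w + (grad_f w + penalty_gradient ((*v) A) b \<beta> w) \<bullet> (y - w)
      \<le> f y + penalty ((*v) A) b \<beta> y" for w y
    using convex_on_imp_above_gradient[OF f_convex f_grad, of w y]
      penalty_above_gradient[OF matrix_vector_mul_linear \<beta>_nonneg, of A b w y]
    by (simp add: inner_add_left)
  show "continuous_on UNIV (\<lambda>y. grad_f y + penalty_gradient ((*v) A) b \<beta> y)"
    by (intro continuous_on_add f_C1 continuous_on_penalty_gradient matrix_vector_mul_linear)
qed (simp_all add: algebra_simps)

context
  fixes x :: "nat \<Rightarrow> real^'n" and l :: "nat \<Rightarrow> real^'m" and S :: "real^'n \<Rightarrow> real^'n \<Rightarrow> real"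
  assumes steps: "\<And>k. aalm_step S A b t \<eta> \<beta> \<gamma> \<delta> x l (Suc k)"
begin

lemma aalm_step_dual_residual: "residual l k = \<delta> *\<^sub>R (A *v overshoot x k - b)"
  using steps[of k] \<eta>_pos unfolding aalm_step_def Let_def
  by (simp add: inertial_def extrapolate_def diff_divide_distrib algebra_simps)

lemma aalm_step_primal_residual:
  assumes s: "(S (inertial (\<lambda>k. t (Suc k)) x k) has_derivative (\<lambda>h. s \<bullet> h)) (at (x (Suc (Suc k))))"
  shows "residual x k = - \<gamma> *\<^sub>R (s + penalty_gradient ((*v) A) b \<beta> (x (Suc (Suc k)))
    + adjoint ((*v) A) (overshoot l k))"
proof -
  let ?X = "x (Suc (Suc k))" and ?xb = "inertial (\<lambda>k. t (Suc k)) x k"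
    and ?lb = "inertial (\<lambda>k. t (Suc k)) l k"
  define c where "c = t (Suc (Suc k)) / \<eta>"
  define p where "p = c *\<^sub>R ?lb - (c - 1) *\<^sub>R l (Suc k)"
  define r where "r = (c - 1) *\<^sub>R (A *v x (Suc k)) + b"
  have "aalm_obj (S ?xb) A b \<beta> \<gamma> \<delta> ?xb p c r ?X \<le> aalm_obj (S ?xb) A b \<beta> \<gamma> \<delta> ?xb p c r y" for y
    using steps[of k] \<eta>_pos unfolding aalm_step_def Let_def
    by (simp add: p_def r_def c_def inertial_def diff_divide_distrib)
  note stationary = aalm_obj_minimizer_stationary[OF s this]
  have "c *\<^sub>R (A *v ?X) - r = A *v overshoot x k - b"
    by (simp add: r_def c_def extrapolate_def algebra_simps)
  then have "p + c *\<^sub>R \<delta> *\<^sub>R (c *\<^sub>R (A *v ?X) - r) = p + c *\<^sub>R residual l k"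
    by (simp only: aalm_step_dual_residual)
  also have "\<dots> = overshoot l k"
    by (simp add: p_def c_def extrapolate_def algebra_simps)
  finally have multiplier: "p + c *\<^sub>R \<delta> *\<^sub>R (c *\<^sub>R (A *v ?X) - r) = overshoot l k" .
  define u where "u = s + penalty_gradient ((*v) A) b \<beta> ?X + adjoint ((*v) A) (overshoot l k)"
  have "u + (1 / \<gamma>) *\<^sub>R residual x k = 0"
    using stationary unfolding multiplier u_def by (simp only: add_ac)
  then have "\<gamma> *\<^sub>R (u + (1 / \<gamma>) *\<^sub>R residual x k) = 0" by simp
  then have "residual x k = - \<gamma> *\<^sub>R u"
    using \<gamma>_pos by (simp add: scaleR_add_right eq_neg_iff_add_eq_0 add.commute)
  then show ?thesis by (simp only: u_def)
qed

lemma aalm_iterates_converge: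
  assumes s: "\<And>k. (S (inertial (\<lambda>k. t (Suc k)) x k) has_derivative (\<lambda>h. s k \<bullet> h))
        (at (x (Suc (Suc k))))"
    and descent: "\<And>k y. f (x (Suc (Suc k))) - f y
        \<le> s k \<bullet> (x (Suc (Suc k)) - y) + (norm (residual x k))\<^sup>2 / (2 * \<gamma>)"
    and error: "\<And>k. norm (s k - grad_f (x (Suc (Suc k)))) \<le> \<Lambda> * norm (residual x k)"
    and kkt: "kkt_set A b grad_f \<noteq> {}"
  shows "\<exists>p q. (p, q) \<in> kkt_set A b grad_f \<and> x \<longlonglongrightarrow> p \<and> l \<longlonglongrightarrow> q"
proof -
  let ?P = "penalty ((*v) A) b \<beta>" and ?g = "penalty_gradient ((*v) A) b \<beta>"
  interpret inertial_primal_dual "\<lambda>y. f y + ?P y" "\<lambda>y. grad_f y + ?g y" "(*v) A" b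
    "\<lambda>k. t (Suc k)" \<eta> \<gamma> \<delta> \<Lambda> x "\<lambda>k. s k + ?g (x (Suc (Suc k)))" l
  proof
    fix k y
    let ?X = "x (Suc (Suc k))"
    show "residual x k = - \<gamma> *\<^sub>R (s k + ?g ?X + adjoint ((*v) A) (overshoot l k))"
      by (rule aalm_step_primal_residual[OF s])
    show "f ?X + ?P ?X - (f y + ?P y) - (norm (residual x k))\<^sup>2 / (2 * \<gamma>)
        \<le> (s k + ?g ?X) \<bullet> (?X - y)"
      using descent[of k y]
        penalty_above_gradient[OF matrix_vector_mul_linear \<beta>_nonneg, of A b ?X y]
      by (simp add: inner_add_left inner_diff_right)
    show "norm (s k + ?g ?X - (grad_f ?X + ?g ?X)) \<le> \<Lambda> * norm (residual x k)"
      using error[of k] by simp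
  qed (rule \<gamma>_pos \<delta>_pos aalm_step_dual_residual)+
  have "kkt_points ((*v) A) b (\<lambda>y. grad_f y + ?g y) = kkt_set A b grad_f"
    by (simp add: kkt_points_penalty kkt_set_eq_kkt_points)
  with iterates_converge kkt show ?thesis by metis
qed

end

theorem exact_aalm_converges:
  assumes "\<And>k. aalm_step (\<lambda>xb. f) A b t \<eta> \<beta> \<gamma> \<delta> x l (Suc k)" and "kkt_set A b grad_f \<noteq> {}"
  shows "\<exists>p q. (p, q) \<in> kkt_set A b grad_f \<and> x \<longlonglongrightarrow> p \<and> l \<longlonglongrightarrow> q"
proof (rule aalm_iterates_converge[OF assms(1) f_grad _ _ assms(2)])
  fix k y
  have "f (x (Suc (Suc k))) - f y \<le> grad_f (x (Suc (Suc k))) \<bullet> (x (Suc (Suc k)) - y)"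
    using convex_on_imp_above_gradient[OF f_convex f_grad, of "x (Suc (Suc k))" y]
    by (simp add: inner_diff_right)
  also have "\<dots> \<le> \<dots> + (norm (residual x k))\<^sup>2 / (2 * \<gamma>)" using \<gamma>_pos by simp
  finally show "f (x (Suc (Suc k))) - f y
    \<le> grad_f (x (Suc (Suc k))) \<bullet> (x (Suc (Suc k)) - y) + (norm (residual x k))\<^sup>2 / (2 * \<gamma>)" .
  show "norm (grad_f (x (Suc (Suc k))) - grad_f (x (Suc (Suc k)))) \<le> 0 * norm (residual x k)"
    by simp
qed

theorem linearized_aalm_converges:
  assumes lipschitz: "L-lipschitz_on UNIV grad_f" and "\<gamma> * L \<le> 1"
    and steps: "\<And>k. aalm_step (\<lambda>xb y. grad_f xb \<bullet> y) A b t \<eta> \<beta> \<gamma> \<delta> x l (Suc k)"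
    and kkt: "kkt_set A b grad_f \<noteq> {}"
  shows "\<exists>p q. (p, q) \<in> kkt_set A b grad_f \<and> x \<longlonglongrightarrow> p \<and> l \<longlonglongrightarrow> q"
proof (rule aalm_iterates_converge[OF steps, where \<Lambda> = L
      and s = "\<lambda>k. grad_f (inertial (\<lambda>k. t (Suc k)) x k)"])
  fix k y
  let ?X = "x (Suc (Suc k))" and ?q = "inertial (\<lambda>k. t (Suc k)) x k"
  show "((\<lambda>y. grad_f ?q \<bullet> y) has_derivative (\<lambda>h. grad_f ?q \<bullet> h)) (at ?X)"
    by (rule bounded_linear_imp_has_derivative[OF bounded_linear_inner_right])
  have "f ?X - f y \<le> grad_f ?q \<bullet> (?X - y) + L / 2 * (norm (?X - ?q))\<^sup>2"
    by (rule convex_lipschitz_gradient_three_points[OF f_convex f_grad lipschitz])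
  also have "L / 2 \<le> 1 / (2 * \<gamma>)" using assms(2) \<gamma>_pos by (simp add: field_simps)
  finally show "f ?X - f y \<le> grad_f ?q \<bullet> (?X - y) + (norm (?X - ?q))\<^sup>2 / (2 * \<gamma>)"
    by (simp add: mult_right_mono)
  show "norm (grad_f ?q - grad_f ?X) \<le> L * norm (?X - ?q)"
    using lipschitz_onD[OF lipschitz, of ?q ?X] by (simp add: dist_norm norm_minus_commute)
qed (rule kkt)

end

theorem theorem4p2:
  fixes f :: "real^'n \<Rightarrow> real" and grad_f :: "real^'n \<Rightarrow> real^'n"
    and A :: "real^'n^'m" and b :: "real^'m"
    and t :: "nat \<Rightarrow> real" and \<rho> \<eta> \<gamma> \<delta> \<beta> :: real
    and x :: "nat \<Rightarrow> real^'n" and l :: "nat \<Rightarrow> real^'m"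
  assumes f_convex: "convex_on UNIV f"
    and f_grad: "\<And>z. (f has_derivative (\<lambda>h. grad_f z \<bullet> h)) (at z)"
    and f_C1: "continuous_on UNIV grad_f"
    and kkt_nonempty: "kkt_set A b grad_f \<noteq> {}"
    and t_mono: "\<And>k. k \<ge> 1 \<Longrightarrow> t k \<le> t (k+1)"
    and t_1: "t 1 = 1"
    and t_gt1: "\<And>k. k > 2 \<Longrightarrow> t k > 1"
    and t_lim: "filterlim t at_top sequentially"
    and t_rate: "\<And>k. k \<ge> 1 \<Longrightarrow> (t (k+1))\<^sup>2 - (t k)\<^sup>2 \<le> \<rho> * t (k+1)"
    and \<rho>_pos: "0 < \<rho>" and \<rho>_le1: "\<rho> \<le> 1"
    and \<eta>_ge: "\<rho> \<le> \<eta>" and \<eta>_le1: "\<eta> \<le> 1"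
    and \<gamma>_pos: "0 < \<gamma>" and \<delta>_pos: "0 < \<delta>" and \<beta>_nonneg: "0 \<le> \<beta>"
    and x_init: "x 0 = x 1" and l_init: "l 0 = l 1"
    and iter: "(\<forall>k\<ge>1. aalm_step (\<lambda>xb. f) A b t \<eta> \<beta> \<gamma> \<delta> x l k)
             \<or> (\<exists>L. L-lipschitz_on UNIV grad_f \<and> \<gamma> * L \<le> 1 \<and>
                  (\<forall>k\<ge>1. aalm_step (\<lambda>xb y. grad_f xb \<bullet> y) A b t \<eta> \<beta> \<gamma> \<delta> x l k))"
  shows "\<exists>xs ls. (xs, ls) \<in> kkt_set A b grad_f \<and> x \<longlonglongrightarrow> xs \<and> l \<longlonglongrightarrow> ls"
proof -
  interpret inertial_parameters "\<lambda>k. t (Suc k)" \<eta>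
    by (rule inertial_parameters_shift[OF t_1 t_mono t_lim t_rate \<rho>_pos \<eta>_ge \<eta>_le1])
  interpret accelerated_augmented_lagrangian t \<eta> f grad_f A b \<gamma> \<delta> \<beta>
    by unfold_locales (rule f_convex f_grad f_C1 \<gamma>_pos \<delta>_pos \<beta>_nonneg)+
  show ?thesis
    using iter
  proof (elim disjE exE conjE)
    assume "\<forall>k\<ge>1. aalm_step (\<lambda>xb. f) A b t \<eta> \<beta> \<gamma> \<delta> x l k"
    then show ?thesis by (intro exact_aalm_converges[OF _ kkt_nonempty]) simp
  next
    fix L
    assume "L-lipschitz_on UNIV grad_f" and "\<gamma> * L \<le> 1"
      and "\<forall>k\<ge>1. aalm_step (\<lambda>xb y. grad_f xb \<bullet> y) A b t \<eta> \<beta> \<gamma> \<delta> x l k"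
    then show ?thesis by (intro linearized_aalm_converges[of L, OF _ _ _ kkt_nonempty]) simp_all
  qed
qed

end
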